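(* Let $n\ge 1$ and let $F=(f_1,\dots,f_n):\mathbb{R}^n\to\mathbb{R}^n$ be of class $C^2$, with Jacobian matrix $DF(x)$. Consider the quotient gradient system $$\dot x = Q(x) := -DF(x)^T F(x).$$ Suppose that all equilibrium points of this system are hyperbolic and that they are finite in number. If $\hat x\in\mathbb{R}^n$ satisfies $F(\hat x)=0$, then $\hat x$ is a stable equilibrium point of the quotient gradient system.
   Context: An equilibrium point of $\dot x=Q(x)$ is a point $x$ with $Q(x)=0$. It is hyperbolic if no eigenvalue of the Jacobian $DQ(x)$ has zero real part. A stable equilibrium point is a (hyperbolic) equilibrium point at which all eigenvalues of $DQ$ have negative real part; since $DQ(x)$ is symmetric, this means that $DQ(x)$ is negative definite. *)

theory Defs
  imports "HOL-Analysis.Analysis"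
begin

definition C2_map :: "('a::real_normed_vector \<Rightarrow> 'b::real_normed_vector) \<Rightarrow> bool" where
  "C2_map F \<longleftrightarrow>
     (\<exists>(F' :: 'a \<Rightarrow> 'a \<Rightarrow>\<^sub>L 'b) (F'' :: 'a \<Rightarrow> 'a \<Rightarrow>\<^sub>L 'a \<Rightarrow>\<^sub>L 'b).
        (\<forall>x. (F has_derivative blinfun_apply (F' x)) (at x)) \<and>
        (\<forall>x. (F' has_derivative blinfun_apply (F'' x)) (at x)) \<and>
        continuous_on UNIV F'')"

(* Eigenvalues of a real matrix are taken over the complex numbers. *)
definition eigenvalue_of :: "real^'n^'n \<Rightarrow> complex \<Rightarrow> bool" where
  "eigenvalue_of A l \<longleftrightarrow> (\<exists>v :: complex^'n. v \<noteq> 0 \<and> map_matrix complex_of_real A *v v = l *s v)"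

(* The following notions concern the autonomous system x' = Q x. *)

definition equilibrium :: "(real^'n \<Rightarrow> real^'n) \<Rightarrow> real^'n \<Rightarrow> bool" where
  "equilibrium Q x \<longleftrightarrow> Q x = 0"

definition hyperbolic_at :: "(real^'n \<Rightarrow> real^'n) \<Rightarrow> real^'n \<Rightarrow> bool" where
  "hyperbolic_at Q x \<longleftrightarrow> (\<forall>l. eigenvalue_of (jacobian Q (at x)) l \<longrightarrow> Re l \<noteq> 0)"

definition stable_equilibrium :: "(real^'n \<Rightarrow> real^'n) \<Rightarrow> real^'n \<Rightarrow> bool" where
  "stable_equilibrium Q x \<longleftrightarrow>
     equilibrium Q x \<and> hyperbolic_at Q x \<and>
     (\<forall>l. eigenvalue_of (jacobian Q (at x)) l \<longrightarrow> Re l < 0)"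

definition quotient_gradient :: "(real^'n \<Rightarrow> real^'n) \<Rightarrow> real^'n \<Rightarrow> real^'n" where
  "quotient_gradient F x = - (transpose (jacobian F (at x)) *v F x)"

end

theory Submission
  imports Defs
begin

text \<open>
  At a zero \<open>x\<close> of \<open>F\<close> the second-order terms of \<open>DQ\<close> are multiplied by \<open>F x = 0\<close>, so
  \<open>DQ(x) = - A\<^sup>T A\<close> with \<open>A = DF(x)\<close>. This matrix is negative semidefinite, so its eigenvalues
  have nonpositive real part, and hyperbolicity excludes real part zero.
\<close>

text \<open>Eigenvalues and eigenvectors are complex, while \<open>neg\<close> speaks of real
  vectors only. Since \<open>B\<close> is real, an eigenvector \<open>a + i b\<close> yields two
  real equations, and the real quadratic form can be evaluated at \<open>a\<close> and at
  \<open>b\<close> separately.\<close>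

lemma eigenvalue_of_Re_le_0:
  fixes B :: "real^'n^'n"
  assumes neg: "\<And>x. x \<bullet> (B *v x) \<le> 0" and "eigenvalue_of B l"
  shows "Re l \<le> 0"
proof -
  obtain v where "v \<noteq> 0" and eig: "map_matrix complex_of_real B *v v = l *s v"
    using assms(2) unfolding eigenvalue_of_def by blast
  define a b where "a = (\<chi> i. Re (v $ i))" and "b = (\<chi> i. Im (v $ i))"
  have eig_nth: "(map_matrix complex_of_real B *v v) $ i = l * v $ i" for i
    using eig by simp
  have Ba: "B *v a = Re l *\<^sub>R a - Im l *\<^sub>R b"
    using arg_cong[OF eig_nth, of Re]
    by (simp add: vec_eq_iff a_def b_def matrix_vector_mult_def map_matrix_def)
  have Bb: "B *v b = Re l *\<^sub>R b + Im l *\<^sub>R a"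
    using arg_cong[OF eig_nth, of Im]
    by (simp add: vec_eq_iff a_def b_def matrix_vector_mult_def map_matrix_def)
  \<comment> \<open>The cross terms \<open>- Im l * (a \<bullet> b)\<close> and
    \<open>Im l * (b \<bullet> a)\<close> cancel in the sum, leaving only the real part of
    \<open>l\<close>.\<close>
  have "Re l * (a \<bullet> a + b \<bullet> b) = a \<bullet> (B *v a) + b \<bullet> (B *v b)"
    unfolding Ba Bb by (simp add: inner_simps inner_commute algebra_simps)
  also have "\<dots> \<le> 0"
    using neg[of a] neg[of b] by linarith
  finally have "Re l * (a \<bullet> a + b \<bullet> b) \<le> 0" .
  moreover have "a \<noteq> 0 \<or> b \<noteq> 0"
    using \<open>v \<noteq> 0\<close> by (auto simp: vec_eq_iff a_def b_def complex_eq_iff)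
  then have "a \<bullet> a + b \<bullet> b > 0"
    by (metis add_nonneg_pos add_pos_nonneg inner_ge_zero inner_gt_zero_iff)
  ultimately show ?thesis
    by (simp add: mult_le_0_iff)
qed

text \<open>Serves to replace the transposed Jacobian by inner products with its columns, to which
  the product rule applies directly.\<close>

lemma vector_mult_matrix_nth:
  fixes f :: "real^'n \<Rightarrow> real^'m"
  shows "(y v* matrix f) $ i = y \<bullet> f (axis i 1)"
  by (simp add: vector_matrix_mult_def matrix_def inner_vec_def mult.commute)

lemma neg_gram_mult:
  fixes A :: "real^'n^'m"
  shows "- (transpose A ** A) *v x = - ((A *v x) v* A)"
proof -
  have "- (transpose A ** A) *v x = - ((transpose A ** A) *v x)"
    by (simp add: matrix_vector_mult_def vec_eq_iff sum_negf)
  then show ?thesis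
    by (simp flip: matrix_vector_mul_assoc)
qed

lemma quotient_gradient_has_derivative_at_zero:
  fixes F :: "real^'n \<Rightarrow> real^'n"
  assumes "C2_map F" "F x = 0"
  defines "A \<equiv> jacobian F (at x)"
  shows "(quotient_gradient F has_derivative (\<lambda>h. - (transpose A ** A) *v h)) (at x)"
proof -
  obtain F' :: "real^'n \<Rightarrow> (real^'n) \<Rightarrow>\<^sub>L (real^'n)" and F''
    where F': "\<And>x. (F has_derivative blinfun_apply (F' x)) (at x)"
      and F'': "\<And>x. (F' has_derivative blinfun_apply (F'' x)) (at x)"
    using assms(1) unfolding C2_map_def by blast
  have jac: "jacobian F (at y) = matrix (blinfun_apply (F' y))" for y
    using frechet_derivative_at[OF F'] by (simp add: jacobian_def)
  have A_mult: "A *v h = F' x h" for h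
    using F'[of x] by (simp add: A_def jac matrix_works has_derivative_linear)
  have Q: "quotient_gradient F y $ i = - (F y \<bullet> F' y (axis i 1))" for y i
    by (simp add: quotient_gradient_def jac vector_mult_matrix_nth)
  have A_nth: "(- (transpose A ** A) *v h) $ i = - (F' x h \<bullet> F' x (axis i 1))" for h i
    unfolding neg_gram_mult A_mult by (simp add: A_def jac vector_mult_matrix_nth)
  \<comment> \<open>The product rule gives \<open>- (F x \<bullet> F'' x h (axis i 1) + F' x h
    \<bullet> F' x (axis i 1))\<close>; the first summand vanishes because \<open>F x = 0\<close>,
    and the second is the entry computed in \<open>A_nth\<close>.\<close>
  have "((\<lambda>y. quotient_gradient F y $ i) has_derivative
      (\<lambda>h. (- (transpose A ** A) *v h) $ i)) (at x)" for i
    unfolding Q A_nth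
    by (auto intro!: derivative_eq_intros F' F'' simp: \<open>F x = 0\<close>)
  then show ?thesis
    by (subst has_derivative_componentwise_within) (auto simp: Basis_vec_def inner_axis)
qed

theorem proposition1:
  fixes F :: "real^'n \<Rightarrow> real^'n" and xhat :: "real^'n"
  assumes "C2_map F"
    and "\<forall>x. equilibrium (quotient_gradient F) x \<longrightarrow> hyperbolic_at (quotient_gradient F) x"
    and "finite {x. equilibrium (quotient_gradient F) x}"
    and "F xhat = 0"
  shows "stable_equilibrium (quotient_gradient F) xhat"
proof -
  define A where "A = jacobian F (at xhat)"
  have jac: "jacobian (quotient_gradient F) (at xhat) = - (transpose A ** A)"
    using frechet_derivative_at[OF quotient_gradient_has_derivative_at_zero[OF assms(1,4)]]
    by (metis A_def jacobian_def matrix_of_matrix_vector_mul)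
  \<comment> \<open>Moving the transpose across the inner product turns the form into minus the
    squared norm of \<open>A *v x\<close>.\<close>
  have neg: "x \<bullet> (- (transpose A ** A) *v x) \<le> 0" for x
    by (simp add: neg_gram_mult dot_lmul_matrix inner_commute[of x])
  have eq: "equilibrium (quotient_gradient F) xhat"
    using assms(4) by (simp add: equilibrium_def quotient_gradient_def)
  then have hyp: "hyperbolic_at (quotient_gradient F) xhat"
    using assms(2) by blast
  have "Re l < 0" if "eigenvalue_of (jacobian (quotient_gradient F) (at xhat)) l" for l
  proof -
    have "Re l \<le> 0"
      using eigenvalue_of_Re_le_0[OF neg] that unfolding jac .
    moreover have "Re l \<noteq> 0"
      using hyp that unfolding hyperbolic_at_def by blast
    ultimately show ?thesis by simp
  qed
  with eq hyp show ?thesis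
    unfolding stable_equilibrium_def by blast
qed

end
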